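(* For any graph $G$, $\lceil\vartheta^+(\overline G)\rceil\le\chi^\star(G)\le\chi_q(G)\le\chi(G)$.
   Context: Graphs are finite, undirected, without loops, with at least one vertex; $\overline G$ is the complement of $G$; $\chi(G)$ is the chromatic number; $[t]=\{1,\dots,t\}$. $\mathcal S^d$ denotes the real symmetric $d\times d$ matrices with trace inner product $\langle X,Y\rangle=\mathrm{Tr}(XY)$, and $\mathcal S^d_+$ the positive semidefinite ones; $J$ is the all-ones matrix; $\mathcal{DNN}^n$ is the cone of positive semidefinite matrices in $\mathcal S^n$ with nonnegative entries. With $n=|V(G)|$, $\vartheta^+(\overline G)$ is the minimum $t\in\mathbb R$ for which there is $Z\in\mathcal{DNN}^n$ with $Z-J\succeq0$, $Z_{uu}=t$ for all $u\in V(G)$, and $Z_{uv}=0$ for all $\{u,v\}\in E(G)$. $\chi_q(G)$ is the minimum $t\in\mathbb N$ for which there exist $d\ge1$ and $\rho,\rho_u^i\in\mathcal S^d_+$ ($i\in[t]$, $u\in V(G)$) with: (a) $\langle\rho,\rho\rangle=1$; (b) $\sum_{i\in[t]}\rho_u^i=\rho$ for all $u\in V(G)$; (c) $\langle\rho_u^i,\rho_v^i\rangle=0$ for all $i\in[t]$ and $\{u,v\}\in E(G)$; (d) $\langle\rho_u^i,\rho_u^j\rangle=0$ for all $i\ne j\in[t]$ and $u\in V(G)$. $\chi^\star(G)$ is defined in the same way with only conditions (a), (b), (c). *)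

theory Defs
  imports "HOL-Analysis.Analysis" "Jordan_Normal_Form.Matrix"
begin

text \<open>
  A graph is given by its set of edges, which are two-element sets of vertices; its vertex set is
  a type of class \<^class>\<open>finite\<close>, hence finite and nonempty.

  Matrices indexed by the vertices are of type \<open>real ^ 'v ^ 'v\<close>. The matrices in the definitions
  of the quantum parameters have a size \<open>d\<close> that is existentially quantified, so they
  are of type \<^typ>\<open>real mat\<close>. Both libraries are loaded and use the same infix symbols, which is
  why some operations below are written in prefix form.
\<close>

section \<open>Graphs\<close>

definition simple_graph :: "'v::finite set set \<Rightarrow> bool" where
  "simple_graph E \<longleftrightarrow> (\<forall>e\<in>E. card e = 2)"

definition graph_complement :: "'v::finite set set \<Rightarrow> 'v set set" where
  "graph_complement E = {e. card e = 2 \<and> e \<notin> E}"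

lemma graph_complement_complement:
  "simple_graph E \<Longrightarrow> graph_complement (graph_complement E) = E"
  by (auto simp: simple_graph_def graph_complement_def)

definition proper_coloring :: "'v::finite set set \<Rightarrow> nat \<Rightarrow> ('v \<Rightarrow> nat) \<Rightarrow> bool" where
  "proper_coloring E t c \<longleftrightarrow>
     (\<forall>u. c u \<in> {1..t}) \<and> (\<forall>u v. {u, v} \<in> E \<longrightarrow> c u \<noteq> c v)"

definition chromatic_number :: "'v::finite set set \<Rightarrow> nat" where
  "chromatic_number E = (LEAST t. \<exists>c. proper_coloring E t c)"

section \<open>The parameter \<open>\<vartheta>\<^sup>+\<close>\<close>

definition psd :: "real ^ 'v::finite ^ 'v \<Rightarrow> bool" where
  "psd Z \<longleftrightarrow> Finite_Cartesian_Product.transpose Z = Z \<and> (\<forall>x. inner x (Z *v x) \<ge> 0)"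

definition DNN :: "(real ^ 'v::finite ^ 'v) set" where
  "DNN = {Z. psd Z \<and> (\<forall>u v. vec_nth (vec_nth Z u) v \<ge> 0)}"

definition all_ones :: "real ^ 'v::finite ^ 'v" where
  "all_ones = (\<chi> u v. 1)"

text \<open>
  The zero pattern in the program for \<open>\<vartheta>\<^sup>+(H)\<close> is given by the edges of the complement of \<open>H\<close>;
  for \<open>H = graph_complement E\<close> these are the edges in \<open>E\<close>.
\<close>

definition theta_plus_feasible :: "'v::finite set set \<Rightarrow> real \<Rightarrow> bool" where
  "theta_plus_feasible H t \<longleftrightarrow>
     (\<exists>Z :: real ^ 'v ^ 'v. Z \<in> DNN \<and> psd (Z - all_ones) \<and>
        (\<forall>u. vec_nth (vec_nth Z u) u = t) \<and>
        (\<forall>u v. {u, v} \<in> graph_complement H \<longrightarrow> vec_nth (vec_nth Z u) v = 0))"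

definition theta_plus :: "'v::finite set set \<Rightarrow> real" where
  "theta_plus H = (LEAST t. theta_plus_feasible H t)"

lemma theta_plus_feasible_complement:
  fixes E :: "'v::finite set set"
  assumes "simple_graph E"
  shows "theta_plus_feasible (graph_complement E) t \<longleftrightarrow>
     (\<exists>Z :: real ^ 'v ^ 'v. Z \<in> DNN \<and> psd (Z - all_ones) \<and>
        (\<forall>u. vec_nth (vec_nth Z u) u = t) \<and>
        (\<forall>u v. {u, v} \<in> E \<longrightarrow> vec_nth (vec_nth Z u) v = 0))"
  by (simp add: theta_plus_feasible_def graph_complement_complement[OF assms])

section \<open>The parameters \<open>\<chi>\<^sub>q\<close> and \<open>\<chi>\<^sup>\<star>\<close>\<close>

definition psd_mats :: "nat \<Rightarrow> real mat set" where
  "psd_mats d = {A \<in> carrier_mat d d.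
     transpose_mat A = A \<and> (\<forall>x \<in> carrier_vec d. scalar_prod x (A *\<^sub>v x) \<ge> 0)}"

definition trace_inner :: "real mat \<Rightarrow> real mat \<Rightarrow> real" where
  "trace_inner A B = (\<Sum>k < dim_row A. (A * B) $$ (k, k))"

text \<open>
  The conjuncts after the two membership conditions are (a) \<open>\<langle>\<rho>, \<rho>\<rangle> = 1\<close>, (b) the matrices of each vertex sum
  to \<open>\<rho>\<close>, and (c) orthogonality along edges, with \<open>t\<close> colours and matrices of size \<open>d\<close>.
  The sum in (b) is written entrywise, since \<^typ>\<open>real mat\<close> is not an additive monoid.
\<close>

definition star_coloring ::
    "'v::finite set set \<Rightarrow> nat \<Rightarrow> nat \<Rightarrow> real mat \<Rightarrow> ('v \<Rightarrow> nat \<Rightarrow> real mat) \<Rightarrow> bool" where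
  "star_coloring E t d \<rho> R \<longleftrightarrow>
     \<rho> \<in> psd_mats d \<and> (\<forall>u. \<forall>i\<in>{1..t}. R u i \<in> psd_mats d) \<and>
     trace_inner \<rho> \<rho> = 1 \<and>
     (\<forall>u. mat d d (\<lambda>(k, l). \<Sum>i\<in>{1..t}. R u i $$ (k, l)) = \<rho>) \<and>
     (\<forall>i\<in>{1..t}. \<forall>u v. {u, v} \<in> E \<longrightarrow> trace_inner (R u i) (R v i) = 0)"

definition orthogonal_colors :: "nat \<Rightarrow> ('v::finite \<Rightarrow> nat \<Rightarrow> real mat) \<Rightarrow> bool" where
  "orthogonal_colors t R \<longleftrightarrow>
     (\<forall>u. \<forall>i\<in>{1..t}. \<forall>j\<in>{1..t}. i \<noteq> j \<longrightarrow> trace_inner (R u i) (R u j) = 0)"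

definition chi_star :: "'v::finite set set \<Rightarrow> nat" where
  "chi_star E = (LEAST t. \<exists>d\<ge>1. \<exists>\<rho> R. star_coloring E t d \<rho> R)"

definition chi_q :: "'v::finite set set \<Rightarrow> nat" where
  "chi_q E = (LEAST t. \<exists>d\<ge>1. \<exists>\<rho> R. star_coloring E t d \<rho> R \<and> orthogonal_colors t R)"

end

theory Submission
  imports Defs
begin

text \<open>
  From matrices \<open>\<rho>\<^sub>u\<^sup>i\<close> as in the definition of \<open>\<chi>\<^sup>\<star>\<close> with \<open>t\<close> colours, form
  \<open>X\<^sub>u\<^sub>v = \<Sum>\<^sub>i \<langle>\<rho>\<^sub>u\<^sup>i, \<rho>\<^sub>v\<^sup>i\<rangle>\<close>. It is positive semidefinite and vanishes on edges, and it is entrywise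
  nonnegative because positive semidefinite matrices have nonnegative inner products. The
  Cauchy--Schwarz inequality over the colours gives \<open>(\<Sum>\<^sub>u x\<^sub>u)\<^sup>2 = \<parallel>\<Sum>\<^sub>i \<Sum>\<^sub>u x\<^sub>u \<rho>\<^sub>u\<^sup>i\<parallel>\<^sup>2 \<le> t x\<^sup>T X x\<close>, that is
  \<open>t X - J \<succeq> 0\<close>. Moreover \<open>X\<^sub>u\<^sub>u \<le> \<langle>\<rho>, \<rho>\<rangle> = 1\<close>, so raising the diagonal of \<open>t X\<close> to \<open>t\<close> yields a feasible
  point of the program for \<open>\<vartheta>\<^sup>+\<close>. A proper colouring gives a solution with \<open>d = 1\<close>.
\<close>

section \<open>Inner products of positive semidefinite matrices\<close>

text \<open>The explicit index set \<open>S\<close> allows inductions that remove one index at a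
  time, which a matrix type of fixed size would not.\<close>

definition psd_form_on :: "'a set \<Rightarrow> ('a \<Rightarrow> 'a \<Rightarrow> real) \<Rightarrow> bool" where
  "psd_form_on S f \<longleftrightarrow> (\<forall>x\<in>S. \<forall>y\<in>S. f x y = f y x) \<and>
     (\<forall>c. 0 \<le> (\<Sum>x\<in>S. \<Sum>y\<in>S. c x * c y * f x y))"

lemma quadratic_sum_insert:
  fixes g :: "'a \<Rightarrow> 'a \<Rightarrow> real"
  assumes "finite S" "a \<notin> S" "\<And>x. x \<in> S \<Longrightarrow> g x a = g a x"
  shows "(\<Sum>x\<in>insert a S. \<Sum>y\<in>insert a S. g x y)
    = g a a + 2 * (\<Sum>x\<in>S. g a x) + (\<Sum>x\<in>S. \<Sum>y\<in>S. g x y)"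
proof -
  have "(\<Sum>x\<in>S. g x a) = (\<Sum>x\<in>S. g a x)"
    using assms(3) by (intro sum.cong) auto
  then show ?thesis
    using assms by (simp add: sum.distrib)
qed

text \<open>The test vector is \<open>c\<close> with its value at \<open>a\<close> replaced by
  \<open>s\<close>, so nonnegativity becomes that of a quadratic in the free parameter
  \<open>s\<close>.\<close>

lemma psd_form_on_insert_expand:
  assumes "finite S" "a \<notin> S" "psd_form_on (insert a S) f"
  shows "0 \<le> s\<^sup>2 * f a a + 2 * s * (\<Sum>x\<in>S. c x * f a x) + (\<Sum>x\<in>S. \<Sum>y\<in>S. c x * c y * f x y)"
proof -
  have sym: "f x a = f a x" if "x \<in> S" for x
    using assms(3) that unfolding psd_form_on_def by blast
  define c' where "c' = c(a := s)"
  have "0 \<le> (\<Sum>x\<in>insert a S. \<Sum>y\<in>insert a S. c' x * c' y * f x y)"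
    using assms(3) unfolding psd_form_on_def by blast
  also have "\<dots> = c' a * c' a * f a a + 2 * (\<Sum>x\<in>S. c' a * c' x * f a x)
      + (\<Sum>x\<in>S. \<Sum>y\<in>S. c' x * c' y * f x y)"
    using assms(1,2) by (rule quadratic_sum_insert) (simp add: sym)
  also have "(\<Sum>x\<in>S. c' a * c' x * f a x) = s * (\<Sum>x\<in>S. c x * f a x)"
    unfolding sum_distrib_left c'_def using assms(2) by (intro sum.cong) auto
  also have "(\<Sum>x\<in>S. \<Sum>y\<in>S. c' x * c' y * f x y) = (\<Sum>x\<in>S. \<Sum>y\<in>S. c x * c y * f x y)"
    unfolding c'_def using assms(2) by (intro sum.cong) auto
  finally show ?thesis
    by (simp add: c'_def power2_eq_square algebra_simps)
qed

text \<open>With \<open>f a a = 0\<close> the quadratic in \<open>s\<close> degenerates to an affine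
  function; being nonnegative for every \<open>s\<close>, it must have slope zero.\<close>

lemma psd_form_on_zero_diag:
  assumes "finite S" "a \<notin> S" "psd_form_on (insert a S) f" "f a a = 0" "b \<in> S"
  shows "f a b = 0"
proof (rule ccontr)
  assume nz: "f a b \<noteq> 0"
  have delta: "(\<Sum>x\<in>S. (if x = b then 1 else 0) * h x) = h b" for h :: "'a \<Rightarrow> real"
    using assms(1,5) by (simp add: if_distrib[of "\<lambda>z. z * _"] cong: if_cong)
  have ge: "0 \<le> 2 * s * f a b + f b b" for s
  proof -
    have "(\<Sum>x\<in>S. \<Sum>y\<in>S. (if x = b then 1 else 0) * (if y = b then 1 else 0) * f x y)
        = (\<Sum>x\<in>S. (if x = b then 1 else 0) * (\<Sum>y\<in>S. (if y = b then 1 else 0) * f x y))"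
      by (simp add: sum_distrib_left mult.assoc)
    then show ?thesis
      using psd_form_on_insert_expand[OF assms(1-3), of s "\<lambda>x. if x = b then 1 else 0"] assms(4)
      by (simp only: delta)
  qed
  \<comment> \<open>This \<open>s\<close> gives the affine function the value -1.\<close>
  show False
    using ge[of "- (f b b + 1) / (2 * f a b)"] nz by (simp add: field_simps)
qed

text \<open>The Schur complement; if \<open>f a a = 0\<close>, the correction term is \<open>0\<close> since division by zero gives zero.\<close>

lemma psd_form_on_schur_complement:
  assumes "finite S" "a \<notin> S" "psd_form_on (insert a S) f"
  shows "psd_form_on S (\<lambda>x y. f x y - f a x * f a y / f a a)"
  unfolding psd_form_on_def
proof (intro conjI ballI allI)
  show "f x y - f a x * f a y / f a a = f y x - f a y * f a x / f a a"
    if "x \<in> S" "y \<in> S" for x y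
  proof -
    have "f x y = f y x"
      using assms(3) that unfolding psd_form_on_def by blast
    then show ?thesis by simp
  qed
next
  fix c :: "'a \<Rightarrow> real"
  define L where "L = (\<Sum>x\<in>S. c x * f a x)"
  have L2: "(\<Sum>x\<in>S. \<Sum>y\<in>S. c x * c y * (f a x * f a y / f a a)) = L\<^sup>2 / f a a"
    unfolding L_def power2_eq_square sum_product sum_divide_distrib
    by (intro sum.cong refl) simp
  \<comment> \<open>The choice \<open>s = - L / f a a\<close> minimises the quadratic if
    \<open>f a a\<close> is positive; if it is zero, both sides here vanish.\<close>
  have "(- L / f a a)\<^sup>2 * f a a + 2 * (- L / f a a) * L = - (L\<^sup>2 / f a a)"
    by (cases "f a a = 0") (simp_all add: power2_eq_square)
  then have "0 \<le> (\<Sum>x\<in>S. \<Sum>y\<in>S. c x * c y * f x y) - L\<^sup>2 / f a a"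
    using psd_form_on_insert_expand[OF assms, of "- L / f a a" c] unfolding L_def[symmetric]
    by linarith
  then show "0 \<le> (\<Sum>x\<in>S. \<Sum>y\<in>S. c x * c y * (f x y - f a x * f a y / f a a))"
    unfolding right_diff_distrib sum_subtractf L2 .
qed

lemma psd_form_on_subset:
  assumes "finite S" "a \<notin> S" "psd_form_on (insert a S) f"
  shows "psd_form_on S f"
  unfolding psd_form_on_def
proof (intro conjI ballI allI)
  show "f x y = f y x" if "x \<in> S" "y \<in> S" for x y
    using assms(3) that unfolding psd_form_on_def by blast
  show "0 \<le> (\<Sum>x\<in>S. \<Sum>y\<in>S. c x * c y * f x y)" for c
    using psd_form_on_insert_expand[OF assms, of 0 c] by simp
qed

text \<open>Eliminating \<open>a\<close> splits \<open>f\<close> into its Schur complement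
  \<open>f'\<close> and a rank-one form. The first pairs nonnegatively with \<open>g\<close> by
  induction, the second because the pairing evaluates the form of \<open>g\<close> at a single
  vector.\<close>

lemma psd_form_on_inner_nonneg:
  assumes "finite S" "psd_form_on S f" "psd_form_on S g"
  shows "0 \<le> (\<Sum>x\<in>S. \<Sum>y\<in>S. f x y * g x y)"
  using assms
proof (induction S arbitrary: f rule: finite_induct)
  case empty
  then show ?case by simp
next
  case (insert a S)
  define f' where "f' = (\<lambda>x y. f x y - f a x * f a y / f a a)"
  have sym_f: "f x y = f y x" if "x \<in> insert a S" "y \<in> insert a S" for x y
    using insert.prems(1) that unfolding psd_form_on_def by blast
  have sym_g: "g x y = g y x" if "x \<in> insert a S" "y \<in> insert a S" for x y
    using insert.prems(2) that unfolding psd_form_on_def by blast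
  have "0 \<le> (\<Sum>x\<in>S. \<Sum>y\<in>S. f' x y * g x y)"
    unfolding f'_def
    using insert.IH psd_form_on_schur_complement[OF insert.hyps insert.prems(1)]
      psd_form_on_subset[OF insert.hyps insert.prems(2)] by blast
  \<comment> \<open>Row and column \<open>a\<close> of \<open>f'\<close> vanish: by cancellation if
    \<open>f a a\<close> is nonzero, otherwise because a zero diagonal entry forces a zero
    row.\<close>
  also have "\<dots> = (\<Sum>x\<in>insert a S. \<Sum>y\<in>insert a S. f' x y * g x y)"
  proof -
    have zero: "f' a x = 0" if "x \<in> insert a S" for x
      using psd_form_on_zero_diag[OF insert.hyps insert.prems(1)] that
      by (cases "f a a = 0") (auto simp: f'_def)
    have "f' x a = f' a x" if "x \<in> S" for x
      using sym_f[of x a] that by (simp add: f'_def)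
    then have "f' x a * g x a = f' a x * g a x" if "x \<in> S" for x
      using sym_g[of x a] that by simp
    from quadratic_sum_insert[OF insert.hyps, of "\<lambda>x y. f' x y * g x y", OF this]
    show ?thesis by (simp add: zero)
  qed
  finally have 1: "0 \<le> (\<Sum>x\<in>insert a S. \<Sum>y\<in>insert a S. f' x y * g x y)" .
  have diag: "0 \<le> f a a"
    using psd_form_on_insert_expand[OF insert.hyps insert.prems(1), of 1 "\<lambda>_. 0"] by simp
  \<comment> \<open>The numerator is the form of \<open>g\<close> at the vector
    \<open>f a\<close>.\<close>
  have "0 \<le> (\<Sum>x\<in>insert a S. \<Sum>y\<in>insert a S. f a x * f a y * g x y) / f a a"
    using insert.prems(2) diag unfolding psd_form_on_def by (intro divide_nonneg_nonneg) blast+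
  also have "\<dots> = (\<Sum>x\<in>insert a S. \<Sum>y\<in>insert a S. f a x * f a y / f a a * g x y)"
    unfolding sum_divide_distrib by (intro sum.cong refl) simp
  finally have 2: "0 \<le> (\<Sum>x\<in>insert a S. \<Sum>y\<in>insert a S. f a x * f a y / f a a * g x y)" .
  have "(\<Sum>x\<in>insert a S. \<Sum>y\<in>insert a S. f x y * g x y)
      = (\<Sum>x\<in>insert a S. \<Sum>y\<in>insert a S. f' x y * g x y)
        + (\<Sum>x\<in>insert a S. \<Sum>y\<in>insert a S. f a x * f a y / f a a * g x y)"
    unfolding sum.distrib[symmetric] f'_def by (intro sum.cong refl) (simp add: algebra_simps)
  with 1 2 show ?case by linarith
qed

section \<open>Transfer from forms on index sets to matrices of type \<open>real mat\<close>\<close>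

lemma psd_mats_carrier: "A \<in> psd_mats d \<Longrightarrow> A \<in> carrier_mat d d"
  by (simp add: psd_mats_def)

lemma psd_mats_sym:
  assumes "A \<in> psd_mats d" "k < d" "l < d"
  shows "A $$ (k, l) = A $$ (l, k)"
proof -
  have A: "A \<in> carrier_mat d d" "transpose_mat A = A"
    using assms(1) by (auto simp: psd_mats_def)
  have "transpose_mat A $$ (k, l) = A $$ (l, k)"
    using A(1) assms(2,3) by simp
  then show ?thesis by (simp add: A(2))
qed

lemma psd_mats_psd_form_on:
  assumes "A \<in> psd_mats d"
  shows "psd_form_on {0..<d} (\<lambda>k l. A $$ (k, l))"
  unfolding psd_form_on_def
proof (intro conjI ballI allI)
  fix c :: "nat \<Rightarrow> real"
  have A: "A \<in> carrier_mat d d" by (rule psd_mats_carrier[OF assms])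
  have "0 \<le> scalar_prod (Matrix.vec d c) (A *\<^sub>v Matrix.vec d c)"
    using assms by (auto simp: psd_mats_def)
  also have "\<dots> = (\<Sum>k\<in>{0..<d}. \<Sum>l\<in>{0..<d}. c k * c l * A $$ (k, l))"
    using A by (auto simp: scalar_prod_def sum_distrib_left intro!: sum.cong)
  finally show "0 \<le> (\<Sum>k\<in>{0..<d}. \<Sum>l\<in>{0..<d}. c k * c l * A $$ (k, l))" .
qed (use psd_mats_sym[OF assms] in auto)

text \<open>Symmetry of \<open>B\<close> removes the transposition hidden in the trace. Indexing by
  pairs \<open>p\<close> treats matrices as vectors with \<open>d * d\<close> coordinates, as the
  sums of squares below require.\<close>

lemma trace_inner_psd_mats:
  assumes "A \<in> psd_mats d" "B \<in> psd_mats d"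
  shows "trace_inner A B = (\<Sum>p\<in>{0..<d} \<times> {0..<d}. A $$ p * B $$ p)"
proof -
  have "A \<in> carrier_mat d d" "B \<in> carrier_mat d d"
    using assms by (auto intro: psd_mats_carrier)
  then have "trace_inner A B = (\<Sum>k\<in>{0..<d}. \<Sum>l\<in>{0..<d}. A $$ (k, l) * B $$ (l, k))"
    unfolding trace_inner_def by (auto simp: scalar_prod_def intro!: sum.cong)
  also have "\<dots> = (\<Sum>k\<in>{0..<d}. \<Sum>l\<in>{0..<d}. A $$ (k, l) * B $$ (k, l))"
    by (intro sum.cong refl) (simp add: psd_mats_sym[OF assms(2)])
  also have "\<dots> = (\<Sum>p\<in>{0..<d} \<times> {0..<d}. A $$ p * B $$ p)"
    unfolding sum.cartesian_product by (intro sum.cong) auto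
  finally show ?thesis .
qed

lemma trace_inner_nonneg:
  assumes "A \<in> psd_mats d" "B \<in> psd_mats d"
  shows "0 \<le> trace_inner A B"
proof -
  have "trace_inner A B = (\<Sum>k\<in>{0..<d}. \<Sum>l\<in>{0..<d}. A $$ (k, l) * B $$ (k, l))"
    unfolding trace_inner_psd_mats[OF assms] sum.cartesian_product by (intro sum.cong) auto
  then show ?thesis
    using psd_form_on_inner_nonneg[OF _ psd_mats_psd_form_on[OF assms(1)] psd_mats_psd_form_on[OF assms(2)]]
    by simp
qed

section \<open>The minimum defining \<open>\<vartheta>\<^sup>+\<close> is attained\<close>

lemma inner_matrix_vector_mult:
  "inner x (Z *v x) = (\<Sum>u\<in>UNIV. \<Sum>v\<in>UNIV. vec_nth x u * vec_nth x v * vec_nth (vec_nth Z u) v)"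
  for Z :: "real ^ 'v::finite ^ 'v"
  by (simp add: inner_vec_def matrix_vector_mult_def sum_distrib_left mult_ac)

lemma transpose_eq_iff:
  "Finite_Cartesian_Product.transpose Z = Z \<longleftrightarrow>
    (\<forall>u v. vec_nth (vec_nth Z u) v = vec_nth (vec_nth Z v) u)"
  for Z :: "real ^ 'v::finite ^ 'v"
  by (simp add: Finite_Cartesian_Product.transpose_def Finite_Cartesian_Product.vec_eq_iff) metis

text \<open>Written entrywise, the conditions are equations and weak inequalities between continuous
  functions of \<open>Z\<close>. The shift \<open>A\<close> serves both \<open>Z\<close> and
  \<open>Z - all_ones\<close>.\<close>

lemma closed_psd: "closed {Z :: real ^ 'v::finite ^ 'v. psd (Z - A)}"
  unfolding psd_def transpose_eq_iff inner_matrix_vector_mult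
  by (intro closed_Collect_conj closed_Collect_all closed_Collect_eq closed_Collect_le continuous_intros)

lemma inner_axis_matrix_axis:
  "inner (axis u 1) (Z *v axis v 1) = vec_nth (vec_nth Z u) v" for Z :: "real ^ 'v::finite ^ 'v"
  by (simp add: inner_axis' matrix_vector_mult_basis column_def)

text \<open>Evaluate the form at the difference of two unit vectors. When the diagonal is constant,
  this bounds every entry by the diagonal value.\<close>

lemma psd_entry_le:
  fixes Z :: "real ^ 'v::finite ^ 'v"
  assumes "psd Z"
  shows "2 * vec_nth (vec_nth Z u) v \<le> vec_nth (vec_nth Z u) u + vec_nth (vec_nth Z v) v"
proof -
  have "0 \<le> inner (axis u 1 - axis v 1) (Z *v (axis u 1 - axis v 1))"
    using assms by (simp add: psd_def)
  moreover have "vec_nth (vec_nth Z u) v = vec_nth (vec_nth Z v) u"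
    using assms by (simp add: psd_def transpose_eq_iff)
  ultimately show ?thesis
    by (simp add: matrix_vector_mult_diff_distrib inner_diff_left inner_diff_right inner_axis_matrix_axis)
qed

text \<open>\<open>LEAST\<close> on the reals has the expected value only if the minimum is
  attained, so compactness is used to produce a minimiser.\<close>

lemma theta_plus_le:
  fixes H :: "'v::finite set set"
  assumes "theta_plus_feasible H T"
  shows "theta_plus H \<le> T"
proof -
  fix w :: 'v
  \<comment> \<open>Asking for a constant diagonal instead of the value \<open>t\<close> makes
    \<open>F\<close> independent of \<open>t\<close>; the feasible values are those of a continuous
    function on \<open>F\<close>. Writing \<open>Z - 0\<close> matches
    \<open>closed_psd\<close>.\<close>
  define F :: "(real ^ 'v ^ 'v) set" where
    "F = {Z. psd (Z - 0) \<and> (\<forall>u v. 0 \<le> vec_nth (vec_nth Z u) v) \<and> psd (Z - all_ones) \<and>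
        (\<forall>u v. vec_nth (vec_nth Z u) u = vec_nth (vec_nth Z v) v) \<and>
        (\<forall>u v. {u, v} \<in> graph_complement H \<longrightarrow> vec_nth (vec_nth Z u) v = 0)}"
  have feas: "theta_plus_feasible H t \<longleftrightarrow> (\<exists>Z\<in>F. vec_nth (vec_nth Z w) w = t)" for t
    unfolding theta_plus_feasible_def F_def DNN_def by auto
  \<comment> \<open>The cutoff at \<open>T\<close> confines all entries to a bounded interval;
    feasible values lost by it exceed \<open>T\<close>, hence also the minimum over
    \<open>K\<close>.\<close>
  define K where "K = F \<inter> {Z. vec_nth (vec_nth Z w) w \<le> T}"
  have "closed F"
    unfolding F_def
    by (intro closed_Collect_conj closed_psd closed_Collect_all closed_Collect_imp open_Collect_const
        closed_Collect_eq closed_Collect_le continuous_intros)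
  then have "closed K"
    unfolding K_def by (intro closed_Int closed_Collect_le continuous_intros)
  moreover have "bounded K"
  proof -
    have "norm Z \<le> (\<Sum>u\<in>(UNIV::'v set). \<Sum>v\<in>(UNIV::'v set). T)" if "Z \<in> K" for Z
    proof -
      have "psd (Z - 0)" and nonneg: "\<And>u v. 0 \<le> vec_nth (vec_nth Z u) v"
        and "vec_nth (vec_nth Z w) w \<le> T"
        and diag: "\<And>u v. vec_nth (vec_nth Z u) u = vec_nth (vec_nth Z v) v"
        using that unfolding K_def F_def by blast+
      then have Z: "psd Z" "vec_nth (vec_nth Z u) u \<le> T" for u
        by (simp_all add: diag[of u w])
      have "vec_nth (vec_nth Z u) v \<le> T" for u v
        using psd_entry_le[OF Z(1), of u v] Z(2)[of u] Z(2)[of v] by linarith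
      then have "norm (vec_nth Z u) \<le> (\<Sum>v\<in>(UNIV::'v set). T)" for u
        by (intro order_trans[OF norm_le_l1_cart] sum_mono) (simp add: nonneg)
      then have "(\<Sum>u\<in>UNIV. norm (vec_nth Z u)) \<le> (\<Sum>u\<in>(UNIV::'v set). \<Sum>v\<in>(UNIV::'v set). T)"
        by (intro sum_mono)
      moreover have "norm Z \<le> (\<Sum>u\<in>UNIV. norm (vec_nth Z u))"
        unfolding norm_vec_def by (rule L2_set_le_sum) simp
      ultimately show ?thesis by linarith
    qed
    then show ?thesis by (rule boundedI)
  qed
  moreover have "K \<noteq> {}"
    using assms unfolding feas K_def by auto
  ultimately obtain Z where Z: "Z \<in> K" "\<And>Y. Y \<in> K \<Longrightarrow> vec_nth (vec_nth Z w) w \<le> vec_nth (vec_nth Y w) w"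
    using continuous_attains_inf[of K "\<lambda>Z. vec_nth (vec_nth Z w) w"]
    by (force simp: compact_eq_bounded_closed intro!: continuous_intros)
  have "theta_plus H = vec_nth (vec_nth Z w) w"
    unfolding theta_plus_def
  proof (rule Least_equality)
    show "theta_plus_feasible H (vec_nth (vec_nth Z w) w)"
      using Z(1) unfolding feas K_def by auto
  next
    fix t assume "theta_plus_feasible H t"
    then obtain Y where Y: "Y \<in> F" "vec_nth (vec_nth Y w) w = t" unfolding feas by auto
    show "vec_nth (vec_nth Z w) w \<le> t"
    proof (cases "t \<le> T")
      case True
      then show ?thesis using Z(2)[of Y] Y by (auto simp: K_def)
    next
      case False
      then show ?thesis using Z(1) by (auto simp: K_def)
    qed
  qed
  then show ?thesis using Z(1) by (simp add: K_def)
qed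

section \<open>Comparison of the parameters\<close>

text \<open>Expand the squares and exchange finite sums. With \<open>r u i p\<close> the entry
  \<open>p\<close> of \<open>R u i\<close>, this prepares the form of \<open>X\<close> for an
  entrywise Cauchy--Schwarz inequality.\<close>

lemma sum_squares_gram:
  fixes r :: "'v \<Rightarrow> 'i \<Rightarrow> 'p \<Rightarrow> real"
  shows "(\<Sum>u\<in>V. \<Sum>v\<in>V. x u * x v * (\<Sum>i\<in>I. \<Sum>p\<in>P. r u i p * r v i p))
    = (\<Sum>i\<in>I. \<Sum>p\<in>P. (\<Sum>u\<in>V. x u * r u i p)\<^sup>2)"
proof -
  have "(\<Sum>u\<in>V. \<Sum>v\<in>V. x u * x v * (\<Sum>i\<in>I. \<Sum>p\<in>P. r u i p * r v i p))
      = (\<Sum>u\<in>V. \<Sum>v\<in>V. \<Sum>i\<in>I. \<Sum>p\<in>P. (x u * r u i p) * (x v * r v i p))"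
    by (simp add: sum_distrib_left mult_ac)
  also have "\<dots> = (\<Sum>u\<in>V. \<Sum>i\<in>I. \<Sum>v\<in>V. \<Sum>p\<in>P. (x u * r u i p) * (x v * r v i p))"
    by (intro sum.cong refl sum.swap)
  also have "\<dots> = (\<Sum>i\<in>I. \<Sum>u\<in>V. \<Sum>v\<in>V. \<Sum>p\<in>P. (x u * r u i p) * (x v * r v i p))"
    by (rule sum.swap)
  also have "\<dots> = (\<Sum>i\<in>I. \<Sum>u\<in>V. \<Sum>p\<in>P. \<Sum>v\<in>V. (x u * r u i p) * (x v * r v i p))"
    by (intro sum.cong refl sum.swap)
  also have "\<dots> = (\<Sum>i\<in>I. \<Sum>p\<in>P. \<Sum>u\<in>V. \<Sum>v\<in>V. (x u * r u i p) * (x v * r v i p))"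
    by (intro sum.cong refl sum.swap)
  finally show ?thesis
    by (simp add: power2_eq_square sum_product)
qed

lemma star_coloring_feasible:
  fixes E :: "'v::finite set set"
  assumes "simple_graph E" "star_coloring E t d \<rho> R"
  shows "theta_plus_feasible (graph_complement E) (real t)"
proof -
  define I where "I = {1..t}"
  define P where "P = {0..<d} \<times> {0..<d}"
  have fin: "finite I" "finite P" "card I = t" by (auto simp: I_def P_def)
  have \<rho>: "\<rho> \<in> psd_mats d" and R: "\<And>u i. i \<in> I \<Longrightarrow> R u i \<in> psd_mats d"
    and unit: "trace_inner \<rho> \<rho> = 1"
    and sum_R: "\<And>u. mat d d (\<lambda>(k, l). \<Sum>i\<in>I. R u i $$ (k, l)) = \<rho>"
    and edge: "\<And>i u v. i \<in> I \<Longrightarrow> {u, v} \<in> E \<Longrightarrow> trace_inner (R u i) (R v i) = 0"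
    using assms(2) unfolding star_coloring_def I_def by simp_all
  have \<rho>_eq: "\<rho> $$ p = (\<Sum>i\<in>I. R u i $$ p)" if "p \<in> P" for u p
  proof -
    have "mat d d (\<lambda>(k, l). \<Sum>i\<in>I. R u i $$ (k, l)) $$ p = (\<Sum>i\<in>I. R u i $$ p)"
      using that by (auto simp: P_def)
    then show ?thesis by (simp only: sum_R)
  qed
  have \<rho>_unit: "(\<Sum>p\<in>P. (\<rho> $$ p)\<^sup>2) = 1"
    using unit trace_inner_psd_mats[OF \<rho> \<rho>] by (simp add: P_def power2_eq_square)
  define X where "X u v = (\<Sum>i\<in>I. trace_inner (R u i) (R v i))" for u v
  have X_gram: "X u v = (\<Sum>i\<in>I. \<Sum>p\<in>P. R u i $$ p * R v i $$ p)" for u v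
    unfolding X_def P_def by (intro sum.cong refl trace_inner_psd_mats R)
  have X_nonneg: "0 \<le> X u v" for u v
    unfolding X_def by (intro sum_nonneg trace_inner_nonneg[where d = d] R)
  have X_sym: "X u v = X v u" for u v
    unfolding X_gram by (simp add: mult.commute)
  have X_diag: "X u u \<le> 1" for u
  proof -
    \<comment> \<open>The terms with distinct \<open>i\<close> and \<open>j\<close> are nonnegative;
      adding them completes the sum to the squared norm of \<rho>.\<close>
    have "X u u \<le> (\<Sum>i\<in>I. \<Sum>j\<in>I. trace_inner (R u i) (R u j))"
      unfolding X_def using fin(1) R
      by (intro sum_mono member_le_sum[where f = "\<lambda>j. trace_inner (R u _) (R u j)"] trace_inner_nonneg[where d = d]) auto
    also have "\<dots> = (\<Sum>i\<in>I. \<Sum>j\<in>I. \<Sum>p\<in>P. R u i $$ p * R u j $$ p)"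
      unfolding P_def by (intro sum.cong refl trace_inner_psd_mats R)
    also have "\<dots> = (\<Sum>i\<in>I. \<Sum>p\<in>P. \<Sum>j\<in>I. R u i $$ p * R u j $$ p)"
      by (intro sum.cong refl sum.swap)
    also have "\<dots> = (\<Sum>p\<in>P. \<Sum>i\<in>I. \<Sum>j\<in>I. R u i $$ p * R u j $$ p)"
      by (rule sum.swap)
    also have "\<dots> = (\<Sum>p\<in>P. (\<rho> $$ p)\<^sup>2)"
      by (intro sum.cong refl) (simp add: \<rho>_eq[of _ u] power2_eq_square sum_product)
    finally show ?thesis using \<rho>_unit by simp
  qed
  have X_ge_J: "(\<Sum>u\<in>UNIV. x u)\<^sup>2 \<le> t * (\<Sum>u\<in>UNIV. \<Sum>v\<in>UNIV. x u * x v * X u v)"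
    for x :: "'v \<Rightarrow> real"
  proof -
    \<comment> \<open>The squared norm of \<rho>, which is 1, enters as a factor so that \<rho> can
      be expanded into the \<open>R u i\<close>, separately for each vertex.\<close>
    have "(\<Sum>u\<in>UNIV. x u)\<^sup>2 = (\<Sum>p\<in>P. (\<Sum>u\<in>UNIV. x u * \<rho> $$ p)\<^sup>2)"
      by (simp flip: sum_distrib_right sum_distrib_left add: power_mult_distrib \<rho>_unit)
    also have "\<dots> = (\<Sum>p\<in>P. (\<Sum>i\<in>I. \<Sum>u\<in>UNIV. x u * R u i $$ p)\<^sup>2)"
    proof (rule sum.cong[OF refl])
      fix p assume p: "p \<in> P"
      have "(\<Sum>u\<in>UNIV. x u * \<rho> $$ p) = (\<Sum>u\<in>UNIV. \<Sum>i\<in>I. x u * R u i $$ p)"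
        by (intro sum.cong refl) (metis \<rho>_eq[OF p] sum_distrib_left)
      also have "\<dots> = (\<Sum>i\<in>I. \<Sum>u\<in>UNIV. x u * R u i $$ p)" by (rule sum.swap)
      finally show "(\<Sum>u\<in>UNIV. x u * \<rho> $$ p)\<^sup>2 = (\<Sum>i\<in>I. \<Sum>u\<in>UNIV. x u * R u i $$ p)\<^sup>2"
        by simp
    qed
    \<comment> \<open>Cauchy--Schwarz against the constant vector 1 on \<open>I\<close>, for each
      entry \<open>p\<close>; this is the source of the factor \<open>t\<close>.\<close>
    also have "\<dots> \<le> (\<Sum>p\<in>P. (\<Sum>i\<in>I. (\<Sum>u\<in>UNIV. x u * R u i $$ p)\<^sup>2) * card I)"
      by (intro sum_mono sum_squared_le_sum_of_squares)
    also have "\<dots> = t * (\<Sum>p\<in>P. \<Sum>i\<in>I. (\<Sum>u\<in>UNIV. x u * R u i $$ p)\<^sup>2)"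
      by (simp add: fin(3) sum_distrib_left mult.commute)
    also have "(\<Sum>p\<in>P. \<Sum>i\<in>I. (\<Sum>u\<in>UNIV. x u * R u i $$ p)\<^sup>2)
        = (\<Sum>u\<in>UNIV. \<Sum>v\<in>UNIV. x u * x v * X u v)"
      unfolding X_gram sum_squares_gram by (rule sum.swap)
    finally show ?thesis .
  qed
  \<comment> \<open>The added diagonal is nonnegative by \<open>X_diag\<close>, brings each diagonal
    entry to exactly \<open>t\<close>, and leaves the zeros at edges untouched.\<close>
  define Z :: "real ^ 'v ^ 'v" where
    "Z = (\<chi> u v. t * X u v + (if u = v then t * (1 - X u u) else 0))"
  have Z: "vec_nth (vec_nth Z u) v = t * X u v + (if u = v then t * (1 - X u u) else 0)" for u v
    by (simp add: Z_def)
  have Z_form: "inner x (Z *v x) = t * (\<Sum>u\<in>UNIV. \<Sum>v\<in>UNIV. vec_nth x u * vec_nth x v * X u v)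
      + (\<Sum>u\<in>UNIV. t * (1 - X u u) * (vec_nth x u)\<^sup>2)" for x
    unfolding inner_matrix_vector_mult Z
    by (simp add: distrib_left sum.distrib sum_distrib_left if_distrib[of "\<lambda>z. _ * z"] power2_eq_square
        mult_ac cong: if_cong)
  have Z_ge_J: "(\<Sum>u\<in>UNIV. vec_nth x u)\<^sup>2 \<le> inner x (Z *v x)" for x
  proof -
    have "0 \<le> (\<Sum>u\<in>UNIV. t * (1 - X u u) * (vec_nth x u)\<^sup>2)"
      using X_diag by (intro sum_nonneg mult_nonneg_nonneg) auto
    then show ?thesis using X_ge_J[of "vec_nth x"] unfolding Z_form by linarith
  qed
  have "psd Z"
    unfolding psd_def transpose_eq_iff
    using order_trans[OF zero_le_power2 Z_ge_J] by (auto simp: Z X_sym)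
  moreover have "psd (Z - all_ones)"
  proof -
    have "inner x (all_ones *v x) = (\<Sum>u\<in>UNIV. vec_nth x u)\<^sup>2" for x :: "real ^ 'v"
      by (simp add: inner_matrix_vector_mult all_ones_def power2_eq_square sum_product)
    then show ?thesis
      unfolding psd_def transpose_eq_iff
      using Z_ge_J
      by (auto simp: Z X_sym all_ones_def[where 'v = 'v] matrix_vector_mult_diff_rdistrib inner_diff_right)
  qed
  moreover have "vec_nth (vec_nth Z u) v = 0" if "{u, v} \<in> E" for u v
  proof -
    have "u \<noteq> v" using assms(1) that by (auto simp: simple_graph_def)
    then show ?thesis using edge[OF _ that] by (simp add: Z X_def)
  qed
  ultimately show ?thesis
    unfolding theta_plus_feasible_complement[OF assms(1)] DNN_def
    using X_nonneg X_diag
    by (intro exI[of _ Z]) (auto simp: Z right_diff_distrib)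
qed

text \<open>The matrices are colour indicators of size one. Their products vanish for adjacent
  vertices at one colour and for two colours at one vertex.\<close>

lemma proper_coloring_star_coloring:
  fixes E :: "'v::finite set set"
  assumes "proper_coloring E t c"
  shows "\<exists>d\<ge>1. \<exists>\<rho> R. star_coloring E t d \<rho> R \<and> orthogonal_colors t R"
proof -
  define S where "S s = mat 1 1 (\<lambda>_. s)" for s :: real
  have psd: "S s \<in> psd_mats (Suc 0)" if "0 \<le> s" for s
    using that by (auto simp: psd_mats_def S_def scalar_prod_def mult.left_commute)
  have inner: "trace_inner (S a) (S b) = a * b" for a b
    by (simp add: trace_inner_def S_def scalar_prod_def)
  define R where "R u i = S (of_bool (c u = i))" for u :: 'v and i
  have c: "c u \<in> {1..t}" "{u, v} \<in> E \<Longrightarrow> c u \<noteq> c v" for u v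
    using assms by (auto simp: proper_coloring_def)
  have "mat 1 1 (\<lambda>(k, l). \<Sum>i\<in>{1..t}. R u i $$ (k, l)) = S 1" for u
  proof -
    have "(\<Sum>i\<in>{1..t}. R u i $$ (0, 0)) = 1"
      using c(1)[of u] by (simp add: R_def S_def of_bool_def)
    then show ?thesis by (intro eq_matI) (auto simp: S_def)
  qed
  then have "star_coloring E t 1 (S 1) R"
    unfolding star_coloring_def using c(2) by (simp add: psd inner R_def) metis
  moreover have "orthogonal_colors t R"
    by (auto simp: orthogonal_colors_def R_def inner)
  ultimately show ?thesis by (intro exI[of _ "1::nat"]) auto
qed

text \<open>Give all vertices distinct colours. This makes the \<open>LEAST\<close> in
  \<open>chromatic_number\<close> meaningful.\<close>

lemma ex_proper_coloring:
  fixes E :: "'v::finite set set"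
  assumes "simple_graph E"
  shows "\<exists>t c. proper_coloring E t c"
proof -
  obtain f :: "'v \<Rightarrow> nat" where f: "bij_betw f UNIV {1..card (UNIV :: 'v set)}"
    using ex_bij_betw_finite_nat[OF finite_class.finite_UNIV]
    by (metis bij_betw_iff_card card_atLeastAtMost diff_Suc_1 finite finite_atLeastAtMost)
  have "u \<noteq> v" if "{u, v} \<in> E" for u v
    using assms that by (auto simp: simple_graph_def)
  with f have "proper_coloring E (card (UNIV :: 'v set)) f"
    unfolding proper_coloring_def bij_betw_def by (auto simp: inj_eq)
  then show ?thesis by blast
qed

theorem corollary4p13:
  fixes E :: "'v::finite set set"
  assumes "simple_graph E"
  shows "\<lceil>theta_plus (graph_complement E)\<rceil> \<le> int (chi_star E)
    \<and> chi_star E \<le> chi_q E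
    \<and> chi_q E \<le> chromatic_number E"
proof (intro conjI)
  \<comment> \<open>Each \<open>LEAST\<close> needs a witness to be attained; the one for
    \<open>chromatic_number\<close> is passed on to \<open>chi_q\<close>, and the one for
    \<open>chi_q\<close> to \<open>chi_star\<close>.\<close>
  have chromatic: "\<exists>c. proper_coloring E (chromatic_number E) c"
    unfolding chromatic_number_def by (rule LeastI_ex[OF ex_proper_coloring[OF assms]])
  then have ex_q: "\<exists>d\<ge>1. \<exists>\<rho> R. star_coloring E (chromatic_number E) d \<rho> R
      \<and> orthogonal_colors (chromatic_number E) R"
    using proper_coloring_star_coloring by blast
  show "chi_q E \<le> chromatic_number E"
    unfolding chi_q_def by (rule Least_le) (rule ex_q)
  have "\<exists>d\<ge>1. \<exists>\<rho> R. star_coloring E (chi_q E) d \<rho> R \<and> orthogonal_colors (chi_q E) R"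
    unfolding chi_q_def by (rule LeastI) (rule ex_q)
  then have ex_star: "\<exists>d\<ge>1. \<exists>\<rho> R. star_coloring E (chi_q E) d \<rho> R"
    by blast
  show "chi_star E \<le> chi_q E"
    unfolding chi_star_def by (rule Least_le) (rule ex_star)
  have "\<exists>d\<ge>1. \<exists>\<rho> R. star_coloring E (chi_star E) d \<rho> R"
    unfolding chi_star_def by (rule LeastI) (rule ex_star)
  then have "theta_plus (graph_complement E) \<le> real (chi_star E)"
    using star_coloring_feasible[OF assms] theta_plus_le by blast
  then show "\<lceil>theta_plus (graph_complement E)\<rceil> \<le> int (chi_star E)"
    by (simp add: ceiling_le_iff)
qed

end
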